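(* Let $\mathbb{K}$ be an infinite field, let $\ell\geq 3$, and let $\mathcal{H}$ be an $\ell$-uniform hypergraph. Then the number of connected components of $\mathcal{H}$ equals $\dim_{\mathbb{K}}\mathrm{Der}(\mathcal{H},C)$.
   Context: Notation: $[\ell]=\{1,\dots,\ell\}$, $\mathrm{Sym}(\ell)$ is the symmetric group on $[\ell]$; for $f\in Y^{[\ell]}$ and $\sigma\in\mathrm{Sym}(\ell)$, $f^{\sigma}(a)=f(a^{\sigma})$. An $\ell$-uniform hypergraph is a pair $\mathcal{H}=(V,E)$ of finite sets where $E$ is a set of orbits of $V^{\ell}$ (functions $[\ell]\to V$) under this action of $\mathrm{Sym}(\ell)$; an edge $e\in E$ is regarded via a representative as an element of $V^{\ell}$, with $e^{\sigma}$ the other elements of its orbit. A walk is a sequence $x_1,e_1,x_2,\dots,e_{m-1},x_m$ of vertices and edges such that for each $i$ there are $a_i,b_i\in[\ell]$ with $e_i(a_i)=x_i$ and $e_i(b_i)=x_{i+1}$; connected components are the classes of the relation "there is a walk from $x$ to $y$". The linear map $C:\mathbb{K}^{\ell}\to\mathbb{K}^{\ell-1}$ is $C(\lambda)(i)=\lambda(i)-\lambda(i+1)$ for $i\in[\ell-1]$. For a linear map $T:\mathbb{K}^{\ell}\to\mathbb{K}^r$, a $T$-signal of $\mathcal{H}$ is a function $\delta:[\ell]\to\mathbb{K}^V$, $a\mapsto\delta_a$, such that for all $e\in E$ and $\sigma\in\mathrm{Sym}(\ell)$, $T(\delta*e^{\sigma})=0$, where $(\delta*e^{\sigma})(a)=\delta_a(e^{\sigma}(a))$.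 $\mathrm{Der}(\mathcal{H},T)$ is the set of $T$-signals, a subspace of the $\mathbb{K}$-vector space $(\mathbb{K}^V)^{\ell}$ (componentwise operations).
   Formalization: The formal theorem additionally assumes that every vertex of the hypergraph lies in some edge; without this the claim fails, since an isolated vertex adds ℓ to dim Der(H,C) but at most 1 to the number of connected components. *)

theory Defs
  imports
    Complex_Main
    "HOL-Library.FuncSet"
    "HOL-Library.Function_Algebras"
    "HOL-Combinatorics.Permutations"
begin

text \<open>
  Elements of \<open>V\<^sup>l\<close>, i.e. functions from \<open>{1..l}\<close> to \<open>V\<close>, are the extensional functions in
  \<open>{1..l} \<rightarrow>\<^sub>E V\<close>. A permutation \<open>\<sigma>\<close> of \<open>{1..l}\<close> fixes everything outside \<open>{1..l}\<close>, so
  \<open>f \<circ> \<sigma>\<close> is again extensional; it is the element written \<open>f\<close> to the power \<open>\<sigma>\<close>.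
\<close>

definition sym_orbit :: "nat \<Rightarrow> (nat \<Rightarrow> 'v) \<Rightarrow> (nat \<Rightarrow> 'v) set" where
  "sym_orbit l f = {f \<circ> \<sigma> | \<sigma>. \<sigma> permutes {1..l}}"

definition uniform_hypergraph :: "nat \<Rightarrow> 'v set \<Rightarrow> (nat \<Rightarrow> 'v) set set \<Rightarrow> bool" where
  "uniform_hypergraph l V E \<longleftrightarrow>
     finite V \<and> finite E \<and> E \<subseteq> sym_orbit l ` ({1..l} \<rightarrow>\<^sub>E V)"

text \<open>
  The vertices \<open>xs\<close> and edges \<open>es\<close> of a walk are listed separately. The walk with a single vertex
  and no edge is allowed. In each step both incidences refer to the same representative of the
  edge; the choice of the representative is immaterial.
\<close>

definition is_walk :: "nat \<Rightarrow> 'v set \<Rightarrow> (nat \<Rightarrow> 'v) set set \<Rightarrow> 'v list \<Rightarrow> (nat \<Rightarrow> 'v) set list \<Rightarrow> bool"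
  where
  "is_walk l V E xs es \<longleftrightarrow>
     set xs \<subseteq> V \<and> set es \<subseteq> E \<and> length xs = length es + 1 \<and>
     (\<forall>i < length es. \<exists>f \<in> es ! i. \<exists>a \<in> {1..l}. \<exists>b \<in> {1..l}. f a = xs ! i \<and> f b = xs ! (i + 1))"

definition walk_rel :: "nat \<Rightarrow> 'v set \<Rightarrow> (nat \<Rightarrow> 'v) set set \<Rightarrow> ('v \<times> 'v) set" where
  "walk_rel l V E = {(x, y). \<exists>xs es. is_walk l V E xs es \<and> hd xs = x \<and> last xs = y}"

definition connected_components :: "nat \<Rightarrow> 'v set \<Rightarrow> (nat \<Rightarrow> 'v) set set \<Rightarrow> 'v set set" where
  "connected_components l V E = V // walk_rel l V E"

text \<open>
  A vertex lying in no edge forms a connected component of its own (by the walk without edges), while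
  its \<open>l\<close> signal values are unconstrained: it contributes \<open>1\<close> to the number of components
  but \<open>l\<close> to the dimension of \<open>Der\<close>. The two numbers therefore agree only if there is no
  such vertex.
\<close>

definition no_isolated_vertices :: "nat \<Rightarrow> 'v set \<Rightarrow> (nat \<Rightarrow> 'v) set set \<Rightarrow> bool" where
  "no_isolated_vertices l V E \<longleftrightarrow> (\<forall>x \<in> V. \<exists>e \<in> E. \<exists>f \<in> e. \<exists>a \<in> {1..l}. f a = x)"

text \<open>
  \<open>\<bbbK>\<^sup>l\<close> is represented by the functions \<open>nat \<Rightarrow> 'k\<close> vanishing outside \<open>{1..l}\<close>, and likewise
  \<open>(\<bbbK>\<^sup>V)\<^sup>l\<close> by the functions in \<open>signal_space l V\<close>; vanishing outside the index set (rather
  than being \<open>undefined\<close> there) makes these linear subspaces of the full function types.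
\<close>

definition signal_space :: "nat \<Rightarrow> 'v set \<Rightarrow> (nat \<Rightarrow> 'v \<Rightarrow> 'k::field) set" where
  "signal_space l V = {\<delta>. \<forall>a x. a \<notin> {1..l} \<or> x \<notin> V \<longrightarrow> \<delta> a x = 0}"

definition signal_scale :: "'k::field \<Rightarrow> (nat \<Rightarrow> 'v \<Rightarrow> 'k) \<Rightarrow> nat \<Rightarrow> 'v \<Rightarrow> 'k" where
  "signal_scale c \<delta> = (\<lambda>a x. c * \<delta> a x)"

definition signal_apply :: "nat \<Rightarrow> (nat \<Rightarrow> 'v \<Rightarrow> 'k::field) \<Rightarrow> (nat \<Rightarrow> 'v) \<Rightarrow> nat \<Rightarrow> 'k" where
  "signal_apply l \<delta> f = (\<lambda>a. if a \<in> {1..l} then \<delta> a (f a) else 0)"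

definition C_map :: "nat \<Rightarrow> (nat \<Rightarrow> 'k::field) \<Rightarrow> nat \<Rightarrow> 'k" where
  "C_map l u = (\<lambda>i. if i \<in> {1..l - 1} then u i - u (i + 1) else 0)"

definition Der ::
    "nat \<Rightarrow> 'v set \<Rightarrow> (nat \<Rightarrow> 'v) set set \<Rightarrow> ((nat \<Rightarrow> 'k::field) \<Rightarrow> nat \<Rightarrow> 'k) \<Rightarrow> (nat \<Rightarrow> 'v \<Rightarrow> 'k) set"
  where
  "Der l V E T = {\<delta> \<in> signal_space l V.
     \<forall>e \<in> E. \<forall>f \<in> e. \<forall>\<sigma>. \<sigma> permutes {1..l} \<longrightarrow> T (signal_apply l \<delta> (f \<circ> \<sigma>)) = 0}"

lemma vector_space_signal_scale:
  "vector_space (signal_scale :: 'k::field \<Rightarrow> (nat \<Rightarrow> 'v \<Rightarrow> 'k) \<Rightarrow> _)"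
  by unfold_locales (auto simp: signal_scale_def fun_eq_iff algebra_simps)

lemma subspace_Der_C_map:
  "module.subspace signal_scale (Der l V E (C_map l) :: (nat \<Rightarrow> 'v \<Rightarrow> 'k::field) set)"
proof -
  interpret vector_space "signal_scale :: 'k \<Rightarrow> (nat \<Rightarrow> 'v \<Rightarrow> 'k) \<Rightarrow> _"
    by (rule vector_space_signal_scale)
  have add: "C_map l (signal_apply l (\<delta> + \<epsilon>) f) =
      C_map l (signal_apply l \<delta> f) + C_map l (signal_apply l \<epsilon> f)"
    for \<delta> \<epsilon> :: "nat \<Rightarrow> 'v \<Rightarrow> 'k" and f
    by (auto simp: C_map_def signal_apply_def fun_eq_iff)
  have scale: "C_map l (signal_apply l (signal_scale c \<delta>) f) =
      (\<lambda>i. c * C_map l (signal_apply l \<delta> f) i)"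
    for c and \<delta> :: "nat \<Rightarrow> 'v \<Rightarrow> 'k" and f
    by (auto simp: C_map_def signal_apply_def signal_scale_def fun_eq_iff algebra_simps)
  have zero: "C_map l (signal_apply l (0 :: nat \<Rightarrow> 'v \<Rightarrow> 'k) f) = 0" for f
    by (auto simp: C_map_def signal_apply_def fun_eq_iff)
  show ?thesis
  proof (rule subspaceI)
    show "0 \<in> (Der l V E (C_map l) :: (nat \<Rightarrow> 'v \<Rightarrow> 'k) set)"
      by (simp add: Der_def signal_space_def zero)
  next
    fix \<delta> \<epsilon> :: "nat \<Rightarrow> 'v \<Rightarrow> 'k"
    assume "\<delta> \<in> Der l V E (C_map l)" "\<epsilon> \<in> Der l V E (C_map l)"
    then show "\<delta> + \<epsilon> \<in> Der l V E (C_map l)"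
      by (simp add: Der_def signal_space_def add)
  next
    fix c :: 'k and \<delta> :: "nat \<Rightarrow> 'v \<Rightarrow> 'k"
    assume "\<delta> \<in> Der l V E (C_map l)"
    then show "signal_scale c \<delta> \<in> Der l V E (C_map l)"
      by (simp add: Der_def signal_space_def scale fun_eq_iff) (simp add: signal_scale_def)
  qed
qed

end

theory Submission
  imports Defs
begin

text \<open>
  With \<open>l \<ge> 3\<close> indices there is enough room to move an edge by permutations so that the equations
  \<open>\<delta> a (f (\<sigma> a)) = \<delta> b (f (\<sigma> b))\<close> force all values \<open>\<delta> a (f p)\<close> on an edge \<open>f\<close> to coincide,
  also those with equal indices or equal positions. Since every vertex lies on an edge, a signal
  is thus the same function of the vertex for every index, and it is constant on connected
  components, so the indicator functions of the components form a basis.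
\<close>

section \<open>Walks as reachability under adjacency\<close>

definition adjacency :: "nat \<Rightarrow> 'v set \<Rightarrow> (nat \<Rightarrow> 'v) set set \<Rightarrow> ('v \<times> 'v) set" where
  "adjacency l V E = {(x, y). x \<in> V \<and> y \<in> V \<and>
     (\<exists>e \<in> E. \<exists>f \<in> e. \<exists>a \<in> {1..l}. \<exists>b \<in> {1..l}. f a = x \<and> f b = y)}"

lemma sym_adjacency: "sym (adjacency l V E)"
  unfolding adjacency_def sym_def by blast

lemma is_walk_Nil: "is_walk l V E xs [] \<longleftrightarrow> (\<exists>x \<in> V. xs = [x])"
  by (cases xs) (auto simp: is_walk_def)

lemma is_walk_Cons:
  "is_walk l V E (x # y # xs) (e # es) \<longleftrightarrow>
     x \<in> V \<and> e \<in> E \<and> (\<exists>f \<in> e. \<exists>a \<in> {1..l}. \<exists>b \<in> {1..l}. f a = x \<and> f b = y) \<and>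
     is_walk l V E (y # xs) es"
proof -
  have "(\<forall>i < Suc n. P i) \<longleftrightarrow> P 0 \<and> (\<forall>i < n. P (Suc i))" for P n
    by (simp add: All_less_Suc2)
  then show ?thesis
    by (simp add: is_walk_def conj_ac del: all_simps)
qed

lemma is_walk_imp_adjacency:
  assumes "is_walk l V E xs es"
  shows "hd xs \<in> V \<and> last xs \<in> V \<and> (hd xs, last xs) \<in> (adjacency l V E)\<^sup>*"
  using assms
proof (induction es arbitrary: xs)
  case Nil
  then show ?case by (auto simp: is_walk_Nil)
next
  case (Cons e es)
  then obtain x y ys where xs: "xs = x # y # ys"
    by (cases xs; cases "tl xs") (auto simp: is_walk_def)
  with Cons.prems have walk: "is_walk l V E (y # ys) es" by (simp add: is_walk_Cons)
  from Cons.IH[OF this] have IH: "y \<in> V" "last (y # ys) \<in> V"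
    "(y, last (y # ys)) \<in> (adjacency l V E)\<^sup>*" by auto
  moreover have "(x, y) \<in> adjacency l V E"
    using Cons.prems IH(1) unfolding xs is_walk_Cons adjacency_def by blast
  ultimately show ?case
    using Cons.prems by (auto simp: xs is_walk_Cons intro: converse_rtrancl_into_rtrancl)
qed

text \<open>Each adjacency step is prepended to the walk as one more vertex and edge. The assumption
  \<open>y \<in> V\<close> serves the empty chain, whose walk is the single vertex
  \<open>y\<close>.\<close>

lemma adjacency_imp_walk_rel:
  assumes "(x, y) \<in> (adjacency l V E)\<^sup>*" "y \<in> V"
  shows "(x, y) \<in> walk_rel l V E"
  using assms
proof (induction rule: converse_rtrancl_induct)
  case base
  then have "is_walk l V E [y] []" by (simp add: is_walk_Nil)
  then show ?case unfolding walk_rel_def by force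
next
  case (step x z)
  then obtain xs es where w: "is_walk l V E xs es" "hd xs = z" "last xs = y"
    unfolding walk_rel_def by auto
  then obtain zs where xs: "xs = z # zs" by (cases xs) (auto simp: is_walk_def)
  from step(1) obtain e where "is_walk l V E (x # xs) (e # es)"
    using w(1) unfolding xs is_walk_Cons adjacency_def by blast
  moreover have "hd (x # xs) = x" "last (x # xs) = y" using w xs by auto
  ultimately show ?case unfolding walk_rel_def by blast
qed

text \<open>Trades vertex and edge lists for a reflexive transitive closure, from which the
  equivalence properties follow. The intersection with \<open>V \<times> V\<close> removes the
  reflexive pairs that the closure has outside \<open>V\<close>.\<close>

lemma walk_rel_eq: "walk_rel l V E = (adjacency l V E)\<^sup>* \<inter> V \<times> V"
proof (rule subset_antisym)
  show "walk_rel l V E \<subseteq> (adjacency l V E)\<^sup>* \<inter> V \<times> V"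
    using is_walk_imp_adjacency by (fastforce simp: walk_rel_def)
  show "(adjacency l V E)\<^sup>* \<inter> V \<times> V \<subseteq> walk_rel l V E"
    using adjacency_imp_walk_rel by fast
qed

lemma equiv_walk_rel: "equiv V (walk_rel l V E)"
proof (rule equivI)
  show "walk_rel l V E \<subseteq> V \<times> V" "refl_on V (walk_rel l V E)"
    by (auto simp: walk_rel_eq refl_on_def)
  show "sym (walk_rel l V E)"
    using sym_rtrancl[OF sym_adjacency[of l V E]] by (auto simp: walk_rel_eq sym_def)
  show "trans (walk_rel l V E)"
    by (auto simp: walk_rel_eq trans_def)
qed

section \<open>The signal equations on a single edge\<close>

lemma uniform_hypergraph_edge_in:
  assumes "uniform_hypergraph l V E" "e \<in> E" "f \<in> e" "p \<in> {1..l}"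
  shows "f p \<in> V"
proof -
  obtain g \<sigma> where "g \<in> {1..l} \<rightarrow>\<^sub>E V" "\<sigma> permutes {1..l}" "f = g \<circ> \<sigma>"
    using assms unfolding uniform_hypergraph_def sym_orbit_def by blast
  moreover from this have "\<sigma> p \<in> {1..l}" using assms(4) permutes_in_image by metis
  ultimately show ?thesis by (auto simp: PiE_iff)
qed

lemma permutes_two_points:
  assumes "a \<in> S" "b \<in> S" "p \<in> S" "q \<in> S" "a \<noteq> b" "p \<noteq> q"
  obtains \<sigma> where "\<sigma> permutes S" "\<sigma> a = p" "\<sigma> b = q"
proof -
  \<comment> \<open>The first transposition sends \<open>a\<close> to \<open>p\<close> and
    \<open>b\<close> to \<open>?b\<close>. The second sends \<open>?b\<close> to \<open>q\<close>
    and leaves \<open>p\<close> alone, since \<open>p\<close> differs from both.\<close>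
  let ?b = "transpose a p b"
  have b: "?b \<in> S" using assms by (auto simp: transpose_def)
  have "?b \<noteq> p" using assms by (auto simp: transpose_def)
  then have "(transpose ?b q \<circ> transpose a p) a = p"
    using assms by (simp add: transpose_def)
  moreover have "(transpose ?b q \<circ> transpose a p) b = q" by simp
  moreover have "(transpose ?b q \<circ> transpose a p) permutes S"
    using assms b by (intro permutes_compose permutes_swap_id)
  ultimately show thesis using that by blast
qed

text \<open>The kernel of C consists of the vectors constant on \<open>{1..l}\<close>, because
  equalities of neighbours chain back to index 1.\<close>

lemma C_map_eq_0_iff:
  "C_map l u = 0 \<longleftrightarrow> (\<forall>a \<in> {1..l}. \<forall>b \<in> {1..l}. u a = u b)"
proof
  assume "C_map l u = 0"
  have step: "u i = u (Suc i)" if "1 \<le> i" "i < l" for i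
    using fun_cong[OF \<open>C_map l u = 0\<close>, of i] that by (auto simp: C_map_def split: if_splits)
  have "u a = u 1" if "1 \<le> a" "a \<le> l" for a
    using that by (induction a rule: nat_induct_at_least) (auto simp flip: step)
  then show "\<forall>a \<in> {1..l}. \<forall>b \<in> {1..l}. u a = u b" by (metis atLeastAtMost_iff)
next
  assume "\<forall>a \<in> {1..l}. \<forall>b \<in> {1..l}. u a = u b"
  then have "u i = u (i + 1)" if "i \<in> {1..l - 1}" for i
    using that by (elim ballE[of _ _ i] ballE[of _ _ "i + 1"]) auto
  then show "C_map l u = 0" unfolding C_map_def fun_eq_iff by simp
qed

text \<open>If \<open>a \<noteq> b\<close> and \<open>p \<noteq> q\<close>, some permutation sends
  \<open>a\<close> to \<open>p\<close> and \<open>b\<close> to \<open>q\<close>. Otherwise take a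
  third index \<open>c\<close> and a third position \<open>r\<close> and go through
  \<open>h c r\<close>. For \<open>l = 2\<close> the hypothesis only relates \<open>h 1 1\<close> to
  \<open>h 2 2\<close> and \<open>h 1 2\<close> to \<open>h 2 1\<close>.\<close>

lemma constant_if_permuted_constant:
  fixes h :: "nat \<Rightarrow> nat \<Rightarrow> 'k"
  assumes l: "l \<ge> 3"
    and h: "\<And>\<sigma> a b. \<lbrakk>\<sigma> permutes {1..l}; a \<in> {1..l}; b \<in> {1..l}\<rbrakk> \<Longrightarrow> h a (\<sigma> a) = h b (\<sigma> b)"
    and ab: "a \<in> {1..l}" "b \<in> {1..l}" and pq: "p \<in> {1..l}" "q \<in> {1..l}"
  shows "h a p = h b q"
proof -
  have distinct: "h a p = h b q"
    if "a \<in> {1..l}" "b \<in> {1..l}" "p \<in> {1..l}" "q \<in> {1..l}" "a \<noteq> b" "p \<noteq> q" for a b p q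
    using permutes_two_points[OF that] h that by metis
  have third: "\<exists>c \<in> {1..l}. c \<noteq> a \<and> c \<noteq> b" for a b :: nat
  proof -
    have "card {a, b} < card {1..l}" using l card_insert_le_m1[of 2 "{b}" a] by simp
    then have "\<not> {1..l} \<subseteq> {a, b}" using card_mono[of "{a, b}" "{1..l}"] by auto
    then show ?thesis by blast
  qed
  obtain c where "c \<in> {1..l}" "c \<noteq> a" "c \<noteq> b" using third by blast
  moreover obtain r where "r \<in> {1..l}" "r \<noteq> p" "r \<noteq> q" using third by blast
  ultimately show ?thesis
    using distinct[of a c p r] distinct[of c b r q] ab pq by auto
qed

text \<open>Eliminates the permutations from the definition of \<open>Der\<close>. Quantifying over
  positions \<open>p\<close>, \<open>q\<close> rather than vertices covers edges with repeated
  vertices.\<close>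

lemma Der_C_map_iff:
  fixes \<delta> :: "nat \<Rightarrow> 'v \<Rightarrow> 'k::field"
  assumes "l \<ge> 3"
  shows "\<delta> \<in> Der l V E (C_map l) \<longleftrightarrow> \<delta> \<in> signal_space l V \<and>
    (\<forall>e \<in> E. \<forall>f \<in> e. \<forall>a \<in> {1..l}. \<forall>b \<in> {1..l}. \<forall>p \<in> {1..l}. \<forall>q \<in> {1..l}. \<delta> a (f p) = \<delta> b (f q))"
proof -
  have "(\<forall>\<sigma>. \<sigma> permutes {1..l} \<longrightarrow> C_map l (signal_apply l \<delta> (f \<circ> \<sigma>)) = 0) \<longleftrightarrow>
    (\<forall>a \<in> {1..l}. \<forall>b \<in> {1..l}. \<forall>p \<in> {1..l}. \<forall>q \<in> {1..l}. \<delta> a (f p) = \<delta> b (f q))"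
    (is "?L \<longleftrightarrow> ?R") for f
  proof
    assume L: ?L
    have "\<delta> a (f (\<sigma> a)) = \<delta> b (f (\<sigma> b))"
      if "\<sigma> permutes {1..l}" "a \<in> {1..l}" "b \<in> {1..l}" for \<sigma> a b
    proof -
      have "signal_apply l \<delta> (f \<circ> \<sigma>) a = signal_apply l \<delta> (f \<circ> \<sigma>) b"
        using L that C_map_eq_0_iff by blast
      then show ?thesis using that by (simp add: signal_apply_def)
    qed
    then show ?R
      using constant_if_permuted_constant[OF assms, of "\<lambda>a p. \<delta> a (f p)"] by blast
  next
    assume R: ?R
    show ?L
    proof (intro allI impI)
      fix \<sigma> assume "\<sigma> permutes {1..l}"
      then have "\<sigma> a \<in> {1..l}" if "a \<in> {1..l}" for a using that permutes_in_image by metis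
      with R have const: "\<delta> a (f (\<sigma> a)) = \<delta> b (f (\<sigma> b))"
        if "a \<in> {1..l}" "b \<in> {1..l}" for a b
        using that by blast
      have "signal_apply l \<delta> (f \<circ> \<sigma>) a = signal_apply l \<delta> (f \<circ> \<sigma>) b"
        if "a \<in> {1..l}" "b \<in> {1..l}" for a b
        using const[OF that] that by (simp add: signal_apply_def)
      then show "C_map l (signal_apply l \<delta> (f \<circ> \<sigma>)) = 0"
        unfolding C_map_eq_0_iff by blast
    qed
  qed
  then show ?thesis unfolding Der_def by simp
qed

text \<open>Equality on one edge propagates along a chain of adjacent vertices, keeping the index
  \<open>a\<close> until the chain ends at \<open>y\<close>.\<close>

lemma Der_C_map_eq:
  assumes l: "l \<ge> 3" and iso: "no_isolated_vertices l V E"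
    and \<delta>: "\<delta> \<in> Der l V E (C_map l)"
    and xy: "(x, y) \<in> walk_rel l V E" and ab: "a \<in> {1..l}" "b \<in> {1..l}"
  shows "\<delta> a x = \<delta> b y"
proof -
  have edge: "\<delta> a (f p) = \<delta> b (f q)"
    if "e \<in> E" "f \<in> e" "a \<in> {1..l}" "b \<in> {1..l}" "p \<in> {1..l}" "q \<in> {1..l}" for e f a b p q
    using \<delta> that unfolding Der_C_map_iff[OF l] by blast
  have "(x, y) \<in> (adjacency l V E)\<^sup>*" "y \<in> V" using xy by (auto simp: walk_rel_eq)
  then show ?thesis using ab(1)
  proof (induction arbitrary: a rule: converse_rtrancl_induct)
    \<comment> \<open>The index changes from \<open>a\<close> to \<open>b\<close> here, at the
      single vertex \<open>y\<close>; this takes an edge through \<open>y\<close>, hence the absence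
      of isolated vertices.\<close>
    case base
    then obtain e f p where "e \<in> E" "f \<in> e" "p \<in> {1..l}" "f p = y"
      using iso unfolding no_isolated_vertices_def by blast
    then show ?case using edge base ab(2) by metis
  next
    case (step x z)
    then obtain e f p q where "e \<in> E" "f \<in> e" "p \<in> {1..l}" "q \<in> {1..l}" "f p = x" "f q = z"
      unfolding adjacency_def by blast
    then have "\<delta> a x = \<delta> a z" using edge step.prems by metis
    then show ?case using step by simp
  qed
qed

section \<open>Indicator signals of components\<close>

definition indicator_signal :: "nat \<Rightarrow> 'v set \<Rightarrow> nat \<Rightarrow> 'v \<Rightarrow> 'k::field" where
  "indicator_signal l X = (\<lambda>a x. if a \<in> {1..l} \<and> x \<in> X then 1 else 0)"

lemma inj_indicator_signal:
  assumes "l \<ge> 1"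
  shows "inj (indicator_signal l :: 'v set \<Rightarrow> nat \<Rightarrow> 'v \<Rightarrow> 'k::field)"
proof (rule injI)
  fix X Y :: "'v set"
  assume eq: "(indicator_signal l X :: nat \<Rightarrow> 'v \<Rightarrow> 'k) = indicator_signal l Y"
  have "x \<in> X \<longleftrightarrow> x \<in> Y" for x
    using fun_cong[OF fun_cong[OF eq, of 1], of x] assms
    by (auto simp: indicator_signal_def split: if_splits)
  then show "X = Y" by blast
qed

text \<open>Classes are disjoint, so at a point of \<open>X\<close> only the summand of
  \<open>X\<close> survives. Evaluation thus reads off coefficients, which serves both independence
  and spanning.\<close>

lemma sum_indicator_signal:
  fixes c :: "'v set \<Rightarrow> 'k::field"
  assumes "equiv V r" "finite (V // r)" "X \<in> V // r" "x \<in> X" "a \<in> {1..l}"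
  shows "(\<Sum>Y \<in> V // r. signal_scale (c Y) (indicator_signal l Y)) a x = c X"
proof -
  have apply_sum: "(\<Sum>Y \<in> A. g Y) a x = (\<Sum>Y \<in> A. g Y a x)"
    for g :: "'v set \<Rightarrow> nat \<Rightarrow> 'v \<Rightarrow> 'k" and A
    by (induction A rule: infinite_finite_induct) auto
  have "x \<in> Y \<longleftrightarrow> Y = X" if "Y \<in> V // r" for Y
    using quotient_disj[OF assms(1) that assms(3)] assms(4) by blast
  then have "(\<Sum>Y \<in> V // r. signal_scale (c Y) (indicator_signal l Y)) a x =
      (\<Sum>Y \<in> V // r. if Y = X then c Y else 0)"
    unfolding apply_sum
    by (intro sum.cong) (use assms(5) in \<open>auto simp: signal_scale_def indicator_signal_def\<close>)
  also have "\<dots> = c X" using assms by simp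
  finally show ?thesis .
qed

text \<open>Two vertices of one edge are joined by a walk, so a component contains both or
  neither.\<close>

lemma indicator_signal_in_Der:
  assumes l: "l \<ge> 3" and H: "uniform_hypergraph l V E"
    and X: "X \<in> connected_components l V E"
  shows "(indicator_signal l X :: nat \<Rightarrow> 'v \<Rightarrow> 'k::field) \<in> Der l V E (C_map l)"
  unfolding Der_C_map_iff[OF l]
proof (intro conjI ballI)
  have "X \<subseteq> V"
    using in_quotient_imp_subset[OF equiv_walk_rel] X unfolding connected_components_def .
  then show "(indicator_signal l X :: nat \<Rightarrow> 'v \<Rightarrow> 'k) \<in> signal_space l V"
    by (auto simp: signal_space_def indicator_signal_def)
next
  fix e f a b p q
  assume ef: "e \<in> E" "f \<in> e" and ab: "a \<in> {1..l}" "b \<in> {1..l}"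
    and pq: "p \<in> {1..l}" "q \<in> {1..l}"
  have "f p \<in> V" "f q \<in> V" using uniform_hypergraph_edge_in[OF H ef] pq by auto
  then have "(f p, f q) \<in> walk_rel l V E" "(f q, f p) \<in> walk_rel l V E"
    using ef pq unfolding walk_rel_eq adjacency_def by blast+
  then have "f p \<in> X \<longleftrightarrow> f q \<in> X"
    using in_quotient_imp_closed[OF equiv_walk_rel X[unfolded connected_components_def]]
    by blast
  then show "indicator_signal l X a (f p) = (indicator_signal l X b (f q) :: 'k)"
    using ab by (simp add: indicator_signal_def)
qed

section \<open>The dimension count\<close>

theorem theorem4p3:
  fixes l :: nat and V :: "'v set" and E :: "(nat \<Rightarrow> 'v) set set"
  assumes "infinite (UNIV :: 'k::field set)"
    and "l \<ge> 3"
    and "uniform_hypergraph l V E"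
    and "no_isolated_vertices l V E"
  shows "card (connected_components l V E) =
    vector_space.dim signal_scale (Der l V E (C_map l) :: (nat \<Rightarrow> 'v \<Rightarrow> 'k) set)"
proof -
  interpret vector_space "signal_scale :: 'k \<Rightarrow> (nat \<Rightarrow> 'v \<Rightarrow> 'k) \<Rightarrow> _"
    by (rule vector_space_signal_scale)
  let ?r = "walk_rel l V E"
  let ?Q = "connected_components l V E"
  let ?\<chi> = "indicator_signal l :: 'v set \<Rightarrow> nat \<Rightarrow> 'v \<Rightarrow> 'k"
  have fin: "finite ?Q"
    using assms(3) equiv_walk_rel unfolding connected_components_def uniform_hypergraph_def
    by (metis finite_quotient equiv_type)
  have inj: "inj_on ?\<chi> ?Q"
    using inj_indicator_signal[of l] assms(2) by (auto intro: inj_on_subset)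
  have sum_chi: "(\<Sum>Y \<in> ?Q. signal_scale (c Y) (?\<chi> Y)) a x = c X"
    if "X \<in> ?Q" "x \<in> X" "a \<in> {1..l}" for c X x a
    unfolding connected_components_def
    by (rule sum_indicator_signal[OF equiv_walk_rel])
      (use fin that in \<open>simp_all add: connected_components_def\<close>)
  have rep: "\<exists>x. x \<in> X" if "X \<in> ?Q" for X
    using in_quotient_imp_non_empty[OF equiv_walk_rel] that
    unfolding connected_components_def by blast
  have "dim (Der l V E (C_map l) :: (nat \<Rightarrow> 'v \<Rightarrow> 'k) set) = card ?Q"
  proof (rule dim_unique)
    show "?\<chi> ` ?Q \<subseteq> Der l V E (C_map l)"
      using indicator_signal_in_Der[OF assms(2,3)] by blast
    show "card (?\<chi> ` ?Q) = card ?Q" by (rule card_image[OF inj])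
    show "independent (?\<chi> ` ?Q)"
    proof (rule independent_if_scalars_zero)
      show "finite (?\<chi> ` ?Q)" using fin by simp
    next
      fix c \<delta>
      assume sum0: "(\<Sum>\<delta> \<in> ?\<chi> ` ?Q. signal_scale (c \<delta>) \<delta>) = 0" and "\<delta> \<in> ?\<chi> ` ?Q"
      then obtain X where X: "X \<in> ?Q" "\<delta> = ?\<chi> X" by blast
      then obtain x where "x \<in> X" using rep by blast
      \<comment> \<open>Here \<open>c\<close> is indexed by signals; injectivity of
        \<open>?\<chi>\<close> turns the sum over its image into one over components, and evaluation
        at a vertex of \<open>X\<close> isolates one coefficient.\<close>
      then have "(\<Sum>Y \<in> ?Q. signal_scale (c (?\<chi> Y)) (?\<chi> Y)) 1 x = c (?\<chi> X)"
        using sum_chi[of X x 1 "\<lambda>Y. c (?\<chi> Y)"] X assms(2) by simp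
      then show "c \<delta> = 0" using sum0 X by (simp add: sum.reindex[OF inj])
    qed
    show "Der l V E (C_map l) \<subseteq> span (?\<chi> ` ?Q)"
    proof
      fix \<delta> :: "nat \<Rightarrow> 'v \<Rightarrow> 'k"
      assume \<delta>: "\<delta> \<in> Der l V E (C_map l)"
      \<comment> \<open>The coefficient is the value of \<open>\<delta>\<close> on \<open>X\<close>;
        neither the index 1 nor the chosen vertex matters, by \<open>Der_C_map_eq\<close>.\<close>
      define c where "c X = \<delta> 1 (SOME x. x \<in> X)" for X
      let ?s = "\<Sum>Y \<in> ?Q. signal_scale (c Y) (?\<chi> Y)"
      have s_span: "?s \<in> span (?\<chi> ` ?Q)"
        by (intro span_sum span_scale span_base) simp
      \<comment> \<open>Membership of \<open>?s\<close> in \<open>Der\<close> is used to see that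
        \<open>?s\<close>, like \<open>\<delta>\<close>, vanishes outside \<open>{1..l}\<close> and
        \<open>V\<close>.\<close>
      have "?\<chi> ` ?Q \<subseteq> Der l V E (C_map l)"
        using indicator_signal_in_Der[OF assms(2,3)] by blast
      then have "?s \<in> Der l V E (C_map l)"
        using s_span span_minimal[OF _ subspace_Der_C_map] by blast
      then have s_space: "?s \<in> signal_space l V" by (simp add: Der_def)
      have "\<delta> a x = ?s a x" for a x
      proof (cases "a \<in> {1..l} \<and> x \<in> V")
        case True
        let ?X = "?r `` {x}"
        have X: "?X \<in> ?Q" using True by (simp add: connected_components_def quotientI)
        have x: "x \<in> ?X" using True by (simp add: walk_rel_eq)
        \<comment> \<open>The chosen vertex lies in the class of \<open>x\<close>, so
          \<open>\<delta>\<close> at \<open>x\<close> with index \<open>a\<close> equals its value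
          there with index 1.\<close>
        then have "(SOME y. y \<in> ?X) \<in> ?X" by (rule someI)
        then have "(x, SOME y. y \<in> ?X) \<in> ?r" by blast
        then have "\<delta> a x = c ?X"
          unfolding c_def using Der_C_map_eq[OF assms(2,4) \<delta>] True assms(2) by simp
        then show ?thesis using sum_chi[OF X x] True by simp
      next
        case False
        then show ?thesis using \<delta> s_space by (auto simp: Der_def signal_space_def)
      qed
      then have "\<delta> = ?s" by (intro ext)
      then show "\<delta> \<in> span (?\<chi> ` ?Q)" using s_span by simp
    qed
  qed
  then show ?thesis by simp
qed

end
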